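(* Let $f:\mathbb{R}\to\mathbb{R}$ be given by $f(x)=|x|\left(1+\sin\left(\frac1x\right)\right)$ for $x\neq0$ and $f(0)=0$, and let $\lambda>0$. Then in any neighborhood of $0$ there exists a point $\bar x$ such that $P_\lambda f$ is not continuous at $\bar x$ and is multivalued at $\bar x$, i.e., $P_\lambda f(\bar x)$ contains at least two distinct elements. Consequently, the proximal mapping $P_\lambda f$ is not locally Lipschitz: there is no neighborhood of $0$ on which $P_\lambda f$ is Lipschitz continuous.
   Context: For $f:\mathbb{R}\to\mathbb{R}$ and $\lambda>0$, the proximal mapping is the set-valued mapping $P_\lambda f:\mathbb{R}\rightrightarrows\mathbb{R}$, $P_\lambda f(x)=\arg\min_{w\in\mathbb{R}}\left\{f(w)+\frac1{2\lambda}(w-x)^2\right\}$. For a set-valued mapping $S:\mathbb{R}\rightrightarrows\mathbb{R}$: $\limsup_{x\to\bar x}S(x)=\{u\mid \exists x^\nu\to\bar x,\ \exists u^\nu\to u \text{ with } u^\nu\in S(x^\nu)\}$; $\liminf_{x\to\bar x}S(x)$ is the set of $u$ such that for every sequence $x^\nu\to\bar x$ there exist a set $N\subseteq\mathbb{N}$ containing all sufficiently large $\nu$ and points $u^\nu\in S(x^\nu)$ for $\nu\in N$ with $u^\nu\to u$. $S$ is continuous at $\bar x$ if both $\limsup_{x\to\bar x}S(x)\subseteq S(\bar x)$ and $\liminf_{x\to\bar x}S(x)\supseteq S(\bar x)$. $S$ is Lipschitz continuous on $X\subseteq\mathbb{R}$ if $S(x)$ is nonempty and closed for every $x\in X$ and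 there exists $\kappa>0$ such that $S(x')\subseteq S(x)+\kappa|x'-x|\,\mathbb{B}$ for all $x,x'\in X$, where $\mathbb{B}=(-1,1)$ is the open unit ball. *)

theory Defs
  imports "HOL-Analysis.Analysis"
begin

definition prox :: "real \<Rightarrow> (real \<Rightarrow> real) \<Rightarrow> real \<Rightarrow> real set" where
  "prox lam f x = {w. is_arg_min (\<lambda>w. f w + 1 / (2 * lam) * (w - x)\<^sup>2) (\<lambda>_. True) w}"

definition outer_limit :: "(real \<Rightarrow> real set) \<Rightarrow> real \<Rightarrow> real set" where
  "outer_limit S a =
    {u. \<exists>xs us. xs \<longlonglongrightarrow> a \<and> us \<longlonglongrightarrow> u \<and> (\<forall>n::nat. us n \<in> S (xs n))}"

text \<open>The points \<open>us n\<close> are only constrained for indices in the cofinite set \<open>N\<close>; the finitely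
  many remaining values do not affect convergence.\<close>

definition inner_limit :: "(real \<Rightarrow> real set) \<Rightarrow> real \<Rightarrow> real set" where
  "inner_limit S a =
    {u. \<forall>xs. xs \<longlonglongrightarrow> a \<longrightarrow>
      (\<exists>(N::nat set) us. (\<forall>\<^sub>F n in sequentially. n \<in> N) \<and> (\<forall>n\<in>N. us n \<in> S (xs n)) \<and> us \<longlonglongrightarrow> u)}"

definition setvalued_continuous_at :: "(real \<Rightarrow> real set) \<Rightarrow> real \<Rightarrow> bool" where
  "setvalued_continuous_at S a \<longleftrightarrow> outer_limit S a \<subseteq> S a \<and> S a \<subseteq> inner_limit S a"

definition setvalued_lipschitz_on :: "(real \<Rightarrow> real set) \<Rightarrow> real set \<Rightarrow> bool" where
  "setvalued_lipschitz_on S X \<longleftrightarrow>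
    (\<forall>x\<in>X. S x \<noteq> {} \<and> closed (S x)) \<and>
    (\<exists>\<kappa>>0. \<forall>x\<in>X. \<forall>x'\<in>X. S x' \<subseteq> {u + \<kappa> * \<bar>x' - x\<bar> * b | u b. u \<in> S x \<and> b \<in> ball 0 1})"

definition osc :: "real \<Rightarrow> real" where
  "osc x = (if x = 0 then 0 else \<bar>x\<bar> * (1 + sin (1 / x)))"

end

theory Submission
  imports Defs
begin

text \<open>
  The proximal mapping is monotone, it fixes every zero of the nonnegative function \<open>osc\<close>, and its
  graph is closed. Let \<open>z' < w < z\<close> be small, where \<open>z'\<close> and \<open>z\<close> are consecutive zeros of \<open>osc\<close> and
  \<open>osc w = 2 * w\<close>. A second-difference estimate at \<open>w\<close> shows that \<open>w\<close> is not a proximal point of any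
  \<open>x\<close>. As \<open>x\<close> moves from \<open>z'\<close> to \<open>z\<close>, the proximal points move from \<open>z'\<close> to \<open>z\<close> and must jump over \<open>w\<close>;
  connectedness gives a point with proximal points on both sides of \<open>w\<close>. By monotonicity, the
  smaller one cannot be approached from the right, which excludes continuity and any Lipschitz bound.
\<close>

lemma prox_iff:
  "w \<in> prox lam f x \<longleftrightarrow>
    (\<forall>y. f w + 1 / (2 * lam) * (w - x)\<^sup>2 \<le> f y + 1 / (2 * lam) * (y - x)\<^sup>2)"
  by (auto simp: prox_def is_arg_min_linorder)

text \<open>Adding the minimality of \<open>u\<close> at \<open>x\<close> against \<open>v\<close>
  and of \<open>v\<close> at \<open>y\<close> against \<open>u\<close> cancels the values of
  \<open>f\<close> and the squares, leaving only a cross term.\<close>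

lemma prox_mono:
  assumes "lam > 0" "x < y" "u \<in> prox lam f x" "v \<in> prox lam f y"
  shows "u \<le> v"
proof -
  define c where "c = 1 / (2 * lam)"
  have c: "c > 0" using assms(1) by (simp add: c_def)
  have "f u + c * (u - x)\<^sup>2 \<le> f v + c * (v - x)\<^sup>2"
       "f v + c * (v - y)\<^sup>2 \<le> f u + c * (u - y)\<^sup>2"
    using assms(3,4) unfolding prox_iff c_def by blast+
  then have "(2 * c * (y - x)) * (u - v) \<le> 0"
    by (simp add: power2_eq_square algebra_simps)
  moreover have "2 * c * (y - x) > 0" using c assms(2) by simp
  ultimately show ?thesis
    by (metis diff_le_0_iff_le mult_le_0_iff not_less)
qed

text \<open>The objective vanishes at \<open>z\<close>, so both of its nonnegative terms vanish at
  any minimiser.\<close>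

lemma prox_zero:
  assumes "lam > 0" "\<And>y. f y \<ge> 0" "f z = 0"
  shows "prox lam f z = {z}"
proof (intro equalityI subsetI)
  fix w assume "w \<in> prox lam f z"
  then have "f w + 1 / (2 * lam) * (w - z)\<^sup>2 \<le> 0"
    unfolding prox_iff using assms(3) by (auto dest: spec[of _ z])
  moreover have "1 / (2 * lam) * (w - z)\<^sup>2 \<ge> 0" using assms(1) by simp
  ultimately have "1 / (2 * lam) * (w - z)\<^sup>2 = 0" using assms(2)[of w] by linarith
  then show "w \<in> {z}" using assms(1) by simp
qed (use assms in \<open>simp add: prox_iff\<close>)

lemma prox_nonempty:
  assumes "lam > 0" "continuous_on UNIV f" "\<And>y. f y \<ge> 0"
  shows "prox lam f x \<noteq> {}"
proof -
  define g where "g w = f w + 1 / (2 * lam) * (w - x)\<^sup>2" for w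
  \<comment> \<open>At distance \<open>R\<close> from \<open>x\<close> the penalty equals
    \<open>f x\<close>, the value of \<open>g\<close> at \<open>x\<close>. Hence points outside the
    ball cannot beat the minimum over it.\<close>
  define R where "R = sqrt (2 * lam * f x)"
  have R: "R \<ge> 0" "R\<^sup>2 = 2 * lam * f x" using assms(1,3) by (auto simp: R_def)
  have "continuous_on (cball x R) g"
    unfolding g_def by (intro continuous_intros continuous_on_subset[OF assms(2)]) auto
  then obtain w where w: "\<And>y. y \<in> cball x R \<Longrightarrow> g w \<le> g y"
    using continuous_attains_inf[of "cball x R" g] R by (metis cball_eq_empty compact_cball not_less)
  have "g w \<le> g y" for y
  proof (cases "y \<in> cball x R")
    case False
    then have "R \<le> \<bar>y - x\<bar>" by (simp add: dist_real_def)
    then have "R\<^sup>2 \<le> (y - x)\<^sup>2" using R(1) by (metis power2_abs power_mono)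
    then have "f x \<le> 1 / (2 * lam) * (y - x)\<^sup>2"
      unfolding R(2) using assms(1) by (simp add: field_simps)
    moreover have "g w \<le> f x" using w[of x] R(1) by (simp add: g_def)
    ultimately show ?thesis using assms(3)[of y] unfolding g_def by linarith
  qed (use w in simp)
  then have "w \<in> prox lam f x" by (simp add: prox_iff g_def)
  then show ?thesis by blast
qed

lemma closed_prox_graph:
  assumes "continuous_on UNIV f"
  shows "closed {(x, w). w \<in> prox lam f x}"
proof -
  have "{(x, w). w \<in> prox lam f x} =
      (\<Inter>y. {p. f (snd p) + 1 / (2 * lam) * (snd p - fst p)\<^sup>2
              \<le> f y + 1 / (2 * lam) * (y - fst p)\<^sup>2})"
    by (auto simp: prox_iff)
  also have "closed \<dots>"
    by (intro closed_INT ballI closed_Collect_le continuous_intros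
        continuous_on_compose2[OF assms]) auto
  finally show ?thesis .
qed

text \<open>This set is the projection of a compact piece of the closed graph.\<close>

lemma closed_prox_preimage:
  assumes "continuous_on UNIV f"
  shows "closed {x \<in> {a..b}. \<exists>w \<in> {c..d}. w \<in> prox lam f x}"
proof -
  have "compact (({a..b} \<times> {c..d}) \<inter> {(x, w). w \<in> prox lam f x})"
    by (intro compact_Int_closed compact_Times closed_prox_graph assms) auto
  then have "compact (fst ` (({a..b} \<times> {c..d}) \<inter> {(x, w). w \<in> prox lam f x}))"
    by (rule compact_continuous_image[rotated]) (intro continuous_intros)
  also have "fst ` (({a..b} \<times> {c..d}) \<inter> {(x, w). w \<in> prox lam f x}) =
      {x \<in> {a..b}. \<exists>w \<in> {c..d}. w \<in> prox lam f x}"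
    by force
  finally show ?thesis by (rule compact_imp_closed)
qed

lemma prox_jump:
  assumes lam: "lam > 0" and cont: "continuous_on UNIV f" and nonneg: "\<And>y. f y \<ge> 0"
    and zeros: "f p = 0" "f q = 0" and "p < w" "w < q"
    and skip: "\<And>x. w \<notin> prox lam f x"
  obtains a u v where "a \<in> {p..q}" "u \<in> prox lam f a" "v \<in> prox lam f a" "u < v"
proof -
  define A where "A = {x \<in> {p..q}. \<exists>u \<in> {p..w}. u \<in> prox lam f x}"
  define B where "B = {x \<in> {p..q}. \<exists>u \<in> {w..q}. u \<in> prox lam f x}"
  have P: "prox lam f p = {p}" "prox lam f q = {q}"
    using prox_zero[OF lam nonneg] zeros by auto
  have "closed A" "closed B"
    unfolding A_def B_def by (intro closed_prox_preimage cont)+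
  moreover have "{p..q} \<subseteq> A \<union> B"
  proof
    fix x assume x: "x \<in> {p..q}"
    obtain u where u: "u \<in> prox lam f x" using prox_nonempty[OF lam cont nonneg] by blast
    \<comment> \<open>Monotonicity needs distinct base points; at the endpoints the proximal set is
      a known singleton.\<close>
    have "p \<le> u"
      using prox_mono[OF lam, of p x p f u] u x P by (cases "p = x") auto
    moreover have "u \<le> q"
      using prox_mono[OF lam, of x q u f q] u x P by (cases "x = q") auto
    ultimately show "x \<in> A \<union> B" using u x by (cases "u \<le> w") (auto simp: A_def B_def)
  qed
  moreover have "p \<in> A \<inter> {p..q}" "q \<in> B \<inter> {p..q}" using P \<open>p < w\<close> \<open>w < q\<close> by (auto simp: A_def B_def)
  ultimately have "A \<inter> B \<inter> {p..q} \<noteq> {}"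
    using connected_closedD[of "{p..q}" A B] connected_Icc by blast
  then obtain a u v where "a \<in> {p..q}" "u \<in> prox lam f a" "v \<in> prox lam f a" "u \<le> w" "w \<le> v"
    unfolding A_def B_def by fastforce
  moreover have "u < v"
    using calculation skip by (metis order_le_less_trans order_less_le)
  ultimately show ?thesis using that by blast
qed

text \<open>Along a sequence decreasing strictly to \<open>a\<close>, monotonicity keeps all
  proximal points at or above \<open>v\<close>, hence away from \<open>u\<close>.\<close>

lemma prox_multivalued_imp_not_continuous:
  assumes lam: "lam > 0" and u: "u \<in> prox lam f a" and v: "v \<in> prox lam f a" and "u < v"
  shows "\<not> setvalued_continuous_at (prox lam f) a"
proof
  assume "setvalued_continuous_at (prox lam f) a"
  then have "u \<in> inner_limit (prox lam f) a"
    using u by (auto simp: setvalued_continuous_at_def)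
  moreover have "(\<lambda>n. a + inverse (real (Suc n))) \<longlonglongrightarrow> a"
    using tendsto_add[OF tendsto_const LIMSEQ_inverse_real_of_nat, of a] by simp
  ultimately obtain N us where N: "\<forall>\<^sub>F n in sequentially. n \<in> N"
      "\<forall>n\<in>N. us n \<in> prox lam f (a + inverse (real (Suc n)))" "us \<longlonglongrightarrow> u"
    unfolding inner_limit_def by blast
  have "\<forall>\<^sub>F n in sequentially. v \<le> us n"
    using N(1)
  proof eventually_elim
    case (elim n)
    then show ?case using prox_mono[OF lam _ v, of "a + inverse (real (Suc n))" "us n"] N(2) by simp
  qed
  then have "v \<le> u" using tendsto_lowerbound[OF N(3)] by simp
  with \<open>u < v\<close> show False by simp
qed

lemma prox_multivalued_imp_not_lipschitz:
  assumes lam: "lam > 0" and u: "u \<in> prox lam f a" and v: "v \<in> prox lam f a" and "u < v"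
    and "a \<in> interior U"
  shows "\<not> setvalued_lipschitz_on (prox lam f) U"
proof
  assume "setvalued_lipschitz_on (prox lam f) U"
  then obtain k where k: "k > 0" and lip: "\<And>x x'. x \<in> U \<Longrightarrow> x' \<in> U \<Longrightarrow>
      prox lam f x' \<subseteq> {u + k * \<bar>x' - x\<bar> * b | u b. u \<in> prox lam f x \<and> b \<in> ball 0 1}"
    unfolding setvalued_lipschitz_on_def by blast
  obtain e where e: "e > 0" "ball a e \<subseteq> U" using \<open>a \<in> interior U\<close> by (auto simp: mem_interior)
  \<comment> \<open>The first bound keeps \<open>a + d\<close> in \<open>U\<close>; the second makes
    the Lipschitz radius \<open>k * d\<close> at most the gap \<open>v - u\<close>.\<close>
  define d where "d = min (e / 2) ((v - u) / k)"
  have d: "d > 0" "d < e" "k * d \<le> v - u"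
    using e k \<open>u < v\<close> by (auto simp: d_def min_def field_simps)
  have "a \<in> U" "a + d \<in> U" using e d by (auto simp: dist_real_def subset_iff)
  from lip[OF this(2,1)] u obtain u' b where b: "u' \<in> prox lam f (a + d)" "\<bar>b\<bar> < 1"
      "u = u' + k * d * b"
    using d(1) by (auto simp: subset_iff)
  have "v \<le> u'" using prox_mono[OF lam _ v b(1)] d by simp
  moreover have "k * d * (- b) < k * d * 1"
    using b(2) k d(1) by (intro mult_strict_left_mono) auto
  ultimately show False using b(3) d(3) by simp
qed

lemma osc_nonneg: "osc x \<ge> 0"
proof -
  have "0 \<le> 1 + sin (1 / x)" using sin_ge_minus_one[of "1 / x"] by linarith
  then show ?thesis by (simp add: osc_def)
qed

lemma osc_le: "osc x \<le> 2 * \<bar>x\<bar>"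
  using mult_left_mono[of "1 + sin (1 / x)" 2 "\<bar>x\<bar>"] sin_le_one[of "1 / x"]
  by (auto simp: osc_def)

lemma continuous_on_osc: "continuous_on UNIV osc"
proof -
  have "isCont osc x" for x
  proof (cases "x = 0")
    case True
    have "((\<lambda>x. 2 * \<bar>x\<bar>) \<longlongrightarrow> 2 * \<bar>0 :: real\<bar>) (at 0)" by (intro tendsto_intros)
    then have "(osc \<longlongrightarrow> 0) (at 0)"
      by (intro tendsto_sandwich[OF _ _ tendsto_const, of 0 osc "at 0"])
        (auto simp: osc_nonneg osc_le)
    then show ?thesis using True by (simp add: isCont_def osc_def)
  next
    case False
    then have "\<forall>\<^sub>F y in nhds x. osc y = \<bar>y\<bar> * (1 + sin (1 / y))"
      by (intro eventually_mono[OF t1_space_nhds[OF False]]) (simp add: osc_def)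
    moreover have "isCont (\<lambda>y. \<bar>y\<bar> * (1 + sin (1 / y))) x"
      using False by (intro continuous_intros)
    ultimately show ?thesis by (simp add: isCont_cong)
  qed
  then show ?thesis by (simp add: continuous_at_imp_continuous_on)
qed

text \<open>Adding the minimality inequalities against \<open>w + t\<close> and \<open>w - t\<close> eliminates \<open>x\<close>.\<close>

lemma osc_peak_notin_prox:
  assumes lam: "lam > 0" and w: "osc w = 2 * w" and "osc (w + t) = 0"
    and t: "0 < t" "t \<le> w" "t < 2 * lam"
  shows "w \<notin> prox lam osc x"
proof
  assume *: "w \<in> prox lam osc x"
  define c where "c = 1 / (2 * lam)"
  have "osc w + c * (w - x)\<^sup>2 \<le> osc (w + t) + c * (w + t - x)\<^sup>2"
       "osc w + c * (w - x)\<^sup>2 \<le> osc (w - t) + c * (w - t - x)\<^sup>2"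
    using * unfolding prox_iff c_def by blast+
  then have "4 * w \<le> osc (w - t) + 2 * c * t\<^sup>2"
    using assms(2,3) by (simp add: power2_eq_square algebra_simps)
  also have "osc (w - t) \<le> 2 * (w - t)" using osc_le[of "w - t"] t by simp
  also have "2 * c * t\<^sup>2 = t / lam * t" by (simp add: c_def power2_eq_square)
  \<comment> \<open>Here \<open>t < 2 * lam\<close> enters. The chain now reads
    \<open>4 * w \<le> 2 * (w - t) + 2 * t\<close>, impossible for positive
    \<open>w\<close>.\<close>
  also have "\<dots> \<le> 2 * t" using t lam by (intro mult_right_mono) (auto simp: field_simps)
  finally show False using t by simp
qed

text \<open>The peak is \<open>1 / s\<close> with \<open>sin s = 1\<close>; its neighbouring zeros
  are \<open>1 / (s + pi)\<close> and \<open>1 / (s - pi)\<close>, where the sine is -1.\<close>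

lemma prox_osc_multivalued_near_0:
  assumes lam: "lam > 0" and "e > 0"
  obtains a u v where "\<bar>a\<bar> < e" "u \<in> prox lam osc a" "v \<in> prox lam osc a" "u < v"
proof -
  \<comment> \<open>The summand 1 forces \<open>k > 1\<close>, which yields
    \<open>s \<ge> 2 * pi\<close>; the reciprocal makes the larger zero smaller than both
    \<open>e\<close> and \<open>2 * lam\<close>.\<close>
  obtain k :: nat where k: "real k > 1 / min e (2 * lam) + 1" using reals_Archimedean2 by blast
  define s where "s = pi / 2 + 2 * real k * pi"
  have m: "min e (2 * lam) > 0" "1 / min e (2 * lam) > 0" using assms by auto
  have "real k * 1 \<le> real k * pi" using pi_gt3 by (intro mult_left_mono) auto
  moreover have "1 * pi \<le> real k * pi" using k m(2) pi_ge_zero by (intro mult_right_mono) linarith+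
  ultimately have s: "s \<ge> 2 * pi" "s - pi > 1 / min e (2 * lam)"
    using k pi_gt_zero unfolding s_def mult.assoc by linarith+
  have "s - pi > 0" "s > 0" "s + pi > 0" using s(1) pi_gt_zero by linarith+
  note pos = this
  have small: "1 / (s - pi) < min e (2 * lam)"
    using s(2) m(1) pos(1) by (simp only: divide_less_eq less_divide_eq mult.commute if_True)
  have "sin s = 1" by (simp add: s_def sin_add)
  then have vals: "osc (1 / s) = 2 * (1 / s)" "osc (1 / (s - pi)) = 0" "osc (1 / (s + pi)) = 0"
    using pos by (auto simp: osc_def)
  have ord: "0 < 1 / (s + pi)" "1 / (s + pi) < 1 / s" "1 / s < 1 / (s - pi)"
    by (intro divide_strict_left_mono divide_pos_pos mult_pos_pos pos; simp)+
  \<comment> \<open>This is the condition \<open>t \<le> w\<close> for \<open>w = 1 / s\<close> and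
    \<open>t = 1 / (s - pi) - 1 / s\<close>.\<close>
  have "1 / (s - pi) \<le> 2 * (1 / s)" using pos s(1) by (simp add: field_simps)
  then have "1 / s \<notin> prox lam osc x" for x
    using osc_peak_notin_prox[OF lam vals(1), of "1 / (s - pi) - 1 / s"] vals(2) ord small pos
    by simp
  from prox_jump[OF lam continuous_on_osc osc_nonneg vals(3,2) ord(2,3) this]
  obtain a u v where "a \<in> {1 / (s + pi)..1 / (s - pi)}"
      "u \<in> prox lam osc a" "v \<in> prox lam osc a" "u < v" by blast
  then show ?thesis using that[of a u v] ord small by auto
qed

theorem theorem3p8:
  fixes lam :: real
  assumes "lam > 0"
  shows "(\<forall>U. 0 \<in> interior U \<longrightarrow>
           (\<exists>a\<in>U. \<not> setvalued_continuous_at (prox lam osc) a \<and>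
                  (\<exists>u\<in>prox lam osc a. \<exists>v\<in>prox lam osc a. u \<noteq> v)))
       \<and> \<not> (\<exists>U. 0 \<in> interior U \<and> setvalued_lipschitz_on (prox lam osc) U)"
proof -
  \<comment> \<open>The point is sought in the interior because the Lipschitz argument needs room to
    its right.\<close>
  have near: "\<exists>a\<in>interior U. \<exists>u\<in>prox lam osc a. \<exists>v\<in>prox lam osc a. u < v"
    if U: "0 \<in> interior U" for U
  proof -
    obtain e where e: "e > 0" "ball 0 e \<subseteq> interior U"
      using U open_contains_ball open_interior by blast
    obtain a u v where "\<bar>a\<bar> < e" "u \<in> prox lam osc a" "v \<in> prox lam osc a" "u < v"
      using prox_osc_multivalued_near_0[OF assms e(1)] by blast
    then show ?thesis using e(2) by (force simp: subset_iff)
  qed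
  show ?thesis
  proof (intro conjI allI impI notI)
    fix U :: "real set" assume "0 \<in> interior U"
    from near[OF this] show "\<exists>a\<in>U. \<not> setvalued_continuous_at (prox lam osc) a \<and>
        (\<exists>u\<in>prox lam osc a. \<exists>v\<in>prox lam osc a. u \<noteq> v)"
      using prox_multivalued_imp_not_continuous[OF assms] interior_subset
      by (metis less_irrefl subsetD)
  next
    assume "\<exists>U. 0 \<in> interior U \<and> setvalued_lipschitz_on (prox lam osc) U"
    then show False
      using near prox_multivalued_imp_not_lipschitz[OF assms] by blast
  qed
qed

end
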